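(* For each integer $n\ge 0$ and each $k\in\{1,2,3,4\}$, $$\overline{SOME}(2^{2k-1}n)\equiv 0\pmod{2^{2k+1}}.$$
   Context: An overpartition of a nonnegative integer $n$ is a partition of $n$ in which the first occurrence of each distinct part may be overlined (or not). For $n\ge 0$, $\overline{SOME}(n)$ denotes the sum, over all overpartitions $\lambda$ of $n$, of (the sum of the odd parts of $\lambda$) minus (the sum of the even parts of $\lambda$), where parts are counted with multiplicity and an overlined part counts with its numerical size; thus $\overline{SOME}(0)=0$. *)

theory Defs
  imports Main "HOL-Library.Multiset" "HOL-Number_Theory.Cong"
begin

text \<open>
  Parts are recorded as a multiset of positive integers. Since only the first occurrence of
  each distinct part size can carry an overline, the overlining is determined by the set of part
  sizes whose first occurrence is overlined: an overpartition is a pair of the multiset of all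
  parts (overlined ones included, with their numerical size) and a set of sizes occurring in it.
\<close>

definition overpartitions :: "nat \<Rightarrow> (nat multiset \<times> nat set) set" where
  "overpartitions n =
     {(P, S). (\<forall>p\<in>#P. 0 < p) \<and> sum_mset P = n \<and> S \<subseteq> set_mset P}"

definition odd_parts_sum :: "nat multiset \<times> nat set \<Rightarrow> nat" where
  "odd_parts_sum \<pi> = sum_mset (filter_mset odd (fst \<pi>))"

definition even_parts_sum :: "nat multiset \<times> nat set \<Rightarrow> nat" where
  "even_parts_sum \<pi> = sum_mset (filter_mset even (fst \<pi>))"

definition SOME_overline :: "nat \<Rightarrow> int" where
  "SOME_overline n =
     (\<Sum>\<pi>\<in>overpartitions n. int (odd_parts_sum \<pi>) - int (even_parts_sum \<pi>))"

text \<open>The sum above ranges over a finite set, so it is not subject to the convention that sums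
  over infinite sets vanish.\<close>

lemma size_le_sum_mset:
  fixes P :: "nat multiset"
  shows "(\<forall>p\<in>#P. 0 < p) \<Longrightarrow> size P \<le> sum_mset P"
  by (induction P) auto

lemma finite_overpartitions: "finite (overpartitions n)"
proof -
  let ?M = "mset ` {xs. set xs \<subseteq> {..n} \<and> length xs \<le> n}"
  have "overpartitions n \<subseteq> ?M \<times> Pow {..n}"
  proof (rule subsetI)
    fix x assume "x \<in> overpartitions n"
    then obtain P S where x: "x = (P, S)" and pos: "\<forall>p\<in>#P. 0 < p"
      and sm: "sum_mset P = n" and S: "S \<subseteq> set_mset P"
      by (auto simp: overpartitions_def)
    obtain xs where xs: "mset xs = P" using ex_mset by blast
    have sub: "set_mset P \<subseteq> {..n}"
    proof
      fix p assume "p \<in># P"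
      then obtain Q where "P = add_mset p Q" by (metis multi_member_split)
      then show "p \<in> {..n}" using sm by auto
    qed
    have "length xs \<le> n" using size_le_sum_mset[OF pos] sm xs by (metis size_mset)
    moreover have "set xs \<subseteq> {..n}" using sub xs by (metis set_mset_mset)
    ultimately have "P \<in> ?M" using xs by blast
    then show "x \<in> ?M \<times> Pow {..n}" using x S sub by auto
  qed
  moreover have "finite (?M \<times> Pow {..n})"
    by (intro finite_cartesian_product finite_imageI finite_lists_length_le) auto
  ultimately show ?thesis by (rule finite_subset)
qed

end

theory Submission
  imports Defs "HOL-Computational_Algebra.Formal_Laurent_Series"
begin

text \<open>
  Everything happens in the ring of integer power series in \<open>q\<close>. Write
  \<open>\<phi>(q) = \<Sum> q^(x^2)\<close> (sum over all integers \<open>x\<close>) and \<open>\<theta> = q d/dq\<close>, and abbreviate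
  \<open>a = \<phi>(q)\<close>, \<open>b = \<phi>(-q)\<close>, \<open>a1 = \<phi>(q^2)\<close>, \<open>b1 = \<phi>(-q^2)\<close>, \<open>a2 = \<phi>(q^4)\<close>. These series satisfy
  the relations of the arithmetic-geometric mean: \<open>a^2 + b^2 = 2 a1^2\<close>, \<open>a b = b1^2\<close> and
  \<open>a + b = 2 a2\<close>.

  Adding one part size at a time shows that the generating function \<open>S\<close> of the weighted sums is
  \<open>P\<close> times \<open>- \<theta>\<close> of the logarithm of \<open>P(-q)\<close>, where \<open>P\<close> is the generating function of
  overpartitions (lemma \<open>weight_gf_eq\<close>). By a theorem of Gauss, \<open>P = 1/b\<close>
  (\<open>overpartition_gf_mult_flip_phi\<close>), so \<open>S = \<theta>a / (a b)\<close> (\<open>SOME_gf_eq\<close>). The denominator is even,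
  and extracting the even coefficients gives the series \<open>S0 = 2 \<theta>(a1) / b^2\<close> whose \<open>N\<close>-th
  coefficient is the weighted sum at \<open>2 N\<close>. The claim is that \<open>8 * 4^t\<close> divides the coefficient of
  \<open>S0\<close> at multiples of \<open>4^t\<close>, where \<open>t = k - 1 \<le> 3\<close>.

  An image under \<open>\<theta>\<close> has its \<open>N\<close>-th coefficient divisible by \<open>N\<close>, so the plan is to write \<open>S0\<close> as
  such an image plus something small. The Wronskian identity
  \<open>4 (b \<theta>a - a \<theta>b) = a b (a^4 - b^4)\<close> (\<open>wronskian_phi\<close>, a form of Jacobi's four-square theorem)
  turns \<open>S0\<close> into \<open>- 2 \<theta>(a1/b^2) + a1 a^2 (a^2 - b^2)/b^2\<close>. In the first summand the factor \<open>N\<close>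
  contributes \<open>4^t\<close>, and the remaining factor 4 comes from \<open>a1/b^2\<close>, which agrees modulo 4 with
  \<open>a1\<close> and hence has coefficients divisible by 4 except at \<open>N = 2 m^2\<close>, where the coefficient is
  even and \<open>N\<close> contains a surplus factor 2 (\<open>quotient_nth\<close>).
  The even part of the second summand is \<open>64 C\<close> with \<open>C = a^3 a1^2 a2 c / b^4\<close>, where
  \<open>a = a2 + 2 c\<close> and \<open>c\<close> runs over the odd squares (\<open>even_section_remainder_gf\<close>). Finally,
  8 divides the coefficients of \<open>C\<close> at multiples of 4, because modulo 8 every term contains either
  an odd power of \<open>c\<close>, which leads to odd exponents only, or \<open>c^2\<close> times a series in \<open>q^4\<close>, and no
  sum of two odd squares is divisible by 4 (\<open>core_gf_nth\<close>). This yields divisibility by 512 for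
  \<open>t \<ge> 2\<close>, which is enough up to \<open>k = 4\<close>; for \<open>t \<le> 1\<close> the constant factors of the second summand
  suffice.
\<close>

unbundle fps_syntax

section \<open>Overpartitions with bounded parts\<close>

definition overpartitions_upto :: "nat \<Rightarrow> nat \<Rightarrow> (nat multiset \<times> nat set) set" where
  "overpartitions_upto m n = {\<pi> \<in> overpartitions n. set_mset (fst \<pi>) \<subseteq> {..m}}"

lemma finite_overpartitions_upto: "finite (overpartitions_upto m n)"
  unfolding overpartitions_upto_def using finite_overpartitions by simp

lemma mem_overpartitions_upto:
  "(P, S) \<in> overpartitions_upto m n \<longleftrightarrow>
     0 \<notin># P \<and> sum_mset P = n \<and> S \<subseteq> set_mset P \<and> set_mset P \<subseteq> {..m}"
  by (auto simp: overpartitions_upto_def overpartitions_def) (metis gr0I)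

lemma overpartitions_upto_0: "overpartitions_upto 0 n = (if n = 0 then {({#}, {})} else {})"
proof -
  have empty: "P = {#}" if "0 \<notin># P" "set_mset P \<subseteq> {..0}" for P :: "nat multiset"
    using that by (cases P) auto
  have "(P, S) \<in> overpartitions_upto 0 n \<longleftrightarrow> n = 0 \<and> P = {#} \<and> S = {}" for P S
  proof (cases "P = {#}")
    case False
    then show ?thesis using empty[of P] by (auto simp only: mem_overpartitions_upto)
  qed (auto simp: mem_overpartitions_upto)
  then show ?thesis by auto
qed

lemma overpartitions_upto_self:
  assumes "n \<le> m"
  shows "overpartitions_upto m n = overpartitions n"
proof -
  have "p \<le> m" if "p \<in># P" "sum_mset P = n" for P :: "nat multiset" and p
    using that assms by (metis sum_mset.remove le_add1 order_trans)
  then show ?thesis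
    by (fastforce simp: overpartitions_upto_def overpartitions_def)
qed

text \<open>
  An overpartition in which the part \<open>Suc m\<close> occurs arises in exactly one of two ways from a
  smaller one: by adding an ordinary copy of \<open>Suc m\<close>, or by adding an overlined copy to an
  overpartition that has no part \<open>Suc m\<close> yet. This is the identity
  \<open>c' = c + q^(m+1) c' + q^(m+1) c\<close> of generating functions, for an arbitrary statistic \<open>f\<close>.
\<close>

lemma sum_overpartitions_upto_Suc:
  fixes f :: "nat multiset \<times> nat set \<Rightarrow> int"
  shows "(\<Sum>\<pi>\<in>overpartitions_upto (Suc m) n. f \<pi>) = (\<Sum>\<pi>\<in>overpartitions_upto m n. f \<pi>) +
    (if Suc m \<le> n then
       (\<Sum>(P, S)\<in>overpartitions_upto (Suc m) (n - Suc m). f (add_mset (Suc m) P, S)) +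
       (\<Sum>(P, S)\<in>overpartitions_upto m (n - Suc m). f (add_mset (Suc m) P, insert (Suc m) S))
     else 0)"
proof -
  define g1 g2 where "g1 = (\<lambda>(P::nat multiset, S::nat set). (add_mset (Suc m) P, S))"
    and "g2 = (\<lambda>(P::nat multiset, S). (add_mset (Suc m) P, insert (Suc m) S))"
  define A where "A = (if Suc m \<le> n then g1 ` overpartitions_upto (Suc m) (n - Suc m) else {})"
  define B where "B = (if Suc m \<le> n then g2 ` overpartitions_upto m (n - Suc m) else {})"
  have no_large: "Suc m \<notin># P \<and> Suc m \<notin> S" if "(P, S) \<in> overpartitions_upto m k" for P S k
    using that by (auto simp: mem_overpartitions_upto)
  have split: "overpartitions_upto (Suc m) n = overpartitions_upto m n \<union> (A \<union> B)"
  proof (rule set_eqI, clarify)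
    fix P S
    show "(P, S) \<in> overpartitions_upto (Suc m) n \<longleftrightarrow> (P, S) \<in> overpartitions_upto m n \<union> (A \<union> B)"
    proof
      assume L: "(P, S) \<in> overpartitions_upto (Suc m) n"
      show "(P, S) \<in> overpartitions_upto m n \<union> (A \<union> B)"
      proof (cases "Suc m \<in># P")
        case False
        then have "set_mset P \<subseteq> {..m}" using L
          by (auto simp: mem_overpartitions_upto) (metis atMost_iff le_SucE subsetD)
        then show ?thesis using L by (simp add: mem_overpartitions_upto)
      next
        case True
        then obtain Q where Q: "P = add_mset (Suc m) Q" by (metis multi_member_split)
        have le: "Suc m \<le> n" and sQ: "sum_mset Q = n - Suc m"
          using L Q by (auto simp: mem_overpartitions_upto)
        show ?thesis
        proof (cases "Suc m \<in> S \<and> Suc m \<notin># Q")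
          case True
          have "set_mset Q \<subseteq> {..m}" using L Q True
            by (auto simp: mem_overpartitions_upto) (metis atMost_iff le_SucE subsetD)
          then have "(Q, S - {Suc m}) \<in> overpartitions_upto m (n - Suc m)"
            using L Q sQ by (auto simp: mem_overpartitions_upto)
          moreover have "(P, S) = g2 (Q, S - {Suc m})" using True Q by (auto simp: g2_def)
          ultimately show ?thesis using le unfolding B_def by auto
        next
          case False
          then have "(Q, S) \<in> overpartitions_upto (Suc m) (n - Suc m)"
            using L Q sQ by (auto simp: mem_overpartitions_upto)
          moreover have "(P, S) = g1 (Q, S)" using Q by (auto simp: g1_def)
          ultimately show ?thesis using le unfolding A_def by auto
        qed
      qed
    next
      assume "(P, S) \<in> overpartitions_upto m n \<union> (A \<union> B)"
      then show "(P, S) \<in> overpartitions_upto (Suc m) n"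
        by (auto simp: A_def B_def g1_def g2_def mem_overpartitions_upto subset_eq le_Suc_eq
            split: if_splits)
    qed
  qed
  have fin: "finite A" "finite B" by (auto simp: A_def B_def finite_overpartitions_upto)
  have d1: "overpartitions_upto m n \<inter> (A \<union> B) = {}"
    using no_large by (auto simp: A_def B_def g1_def g2_def mem_overpartitions_upto subset_eq)
  have d2: "A \<inter> B = {}"
  proof -
    have False if "(P, S) \<in> overpartitions_upto (Suc m) k" "(Q, T) \<in> overpartitions_upto m k"
      "g1 (P, S) = g2 (Q, T)" for P S Q T k
    proof -
      have "P = Q" "Suc m \<in> S" using that(3) by (auto simp: g1_def g2_def)
      then show False using that(1) no_large[OF that(2)] by (auto simp: mem_overpartitions_upto)
    qed
    then show ?thesis by (auto simp: A_def B_def) metis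
  qed
  have i1: "inj_on g1 X" for X by (auto simp: inj_on_def g1_def)
  have i2: "inj_on g2 (overpartitions_upto m k)" for k
  proof (rule inj_onI, clarify)
    fix P S Q T assume a: "(P, S) \<in> overpartitions_upto m k" "(Q, T) \<in> overpartitions_upto m k"
      and e: "g2 (P, S) = g2 (Q, T)"
    have "insert (Suc m) S = insert (Suc m) T" "P = Q" using e by (auto simp: g2_def)
    then show "P = Q \<and> S = T"
      using no_large[OF a(1)] no_large[OF a(2)] by (metis insert_ident)
  qed
  have "(\<Sum>\<pi>\<in>overpartitions_upto (Suc m) n. f \<pi>) = (\<Sum>\<pi>\<in>overpartitions_upto m n. f \<pi>) + (sum f A + sum f B)"
    unfolding split by (simp add: sum.union_disjoint fin finite_overpartitions_upto d1 d2)
  moreover have "sum f A + sum f B = (if Suc m \<le> n then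
       (\<Sum>(P, S)\<in>overpartitions_upto (Suc m) (n - Suc m). f (add_mset (Suc m) P, S)) +
       (\<Sum>(P, S)\<in>overpartitions_upto m (n - Suc m). f (add_mset (Suc m) P, insert (Suc m) S))
     else 0)"
    by (simp add: A_def B_def sum.reindex[OF i1] sum.reindex[OF i2])
       (simp add: g1_def g2_def o_def split_def)
  ultimately show ?thesis by simp
qed

definition signed_part :: "nat \<Rightarrow> int" where
  "signed_part p = (if odd p then int p else - int p)"

definition SOME_weight :: "nat multiset \<times> nat set \<Rightarrow> int" where
  "SOME_weight \<pi> = int (odd_parts_sum \<pi>) - int (even_parts_sum \<pi>)"

text \<open>
  The overlines do not influence the weight, so they may change freely from \<open>S\<close> to \<open>T\<close>.
\<close>

lemma SOME_weight_add: "SOME_weight (add_mset p P, T) = signed_part p + SOME_weight (P, S)"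
  by (simp add: SOME_weight_def signed_part_def odd_parts_sum_def even_parts_sum_def)

definition count_gf :: "nat \<Rightarrow> int fps" where
  "count_gf m = Abs_fps (\<lambda>n. int (card (overpartitions_upto m n)))"

definition weight_gf :: "nat \<Rightarrow> int fps" where
  "weight_gf m = Abs_fps (\<lambda>n. \<Sum>\<pi>\<in>overpartitions_upto m n. SOME_weight \<pi>)"

lemma count_gf_0: "count_gf 0 = 1"
  by (rule fps_ext) (simp add: count_gf_def overpartitions_upto_0)

lemma weight_gf_0: "weight_gf 0 = 0"
  by (rule fps_ext)
     (simp add: weight_gf_def overpartitions_upto_0 SOME_weight_def odd_parts_sum_def
        even_parts_sum_def)

lemma count_gf_Suc:
  "count_gf (Suc m) * (1 - fps_X ^ Suc m) = count_gf m * (1 + fps_X ^ Suc m)"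
proof -
  have "count_gf (Suc m) = count_gf m + fps_X ^ Suc m * (count_gf (Suc m) + count_gf m)"
  proof (rule fps_ext)
    fix n
    show "count_gf (Suc m) $ n = (count_gf m + fps_X ^ Suc m * (count_gf (Suc m) + count_gf m)) $ n"
      using sum_overpartitions_upto_Suc[of "\<lambda>_. 1" m n]
      by (simp add: count_gf_def fps_X_power_mult_nth split_def del: power_Suc)
  qed
  then show ?thesis by (simp add: algebra_simps del: power_Suc)
qed

lemma of_int_eq_fps_const: "(of_int z :: int fps) = fps_const z"
  using fps_of_int[of z, where 'a = int] by simp

lemma weight_gf_Suc:
  "weight_gf (Suc m) * (1 - fps_X ^ Suc m) = weight_gf m * (1 + fps_X ^ Suc m) +
     of_int (signed_part (Suc m)) * fps_X ^ Suc m * (count_gf (Suc m) + count_gf m)"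
proof -
  let ?w = "signed_part (Suc m)"
  have "weight_gf (Suc m) = weight_gf m + fps_X ^ Suc m *
     (weight_gf (Suc m) + weight_gf m + fps_const ?w * (count_gf (Suc m) + count_gf m))"
  proof (rule fps_ext)
    fix n
    have "(\<Sum>(P, S)\<in>overpartitions_upto k j. SOME_weight (add_mset (Suc m) P, T S)) =
       (\<Sum>\<pi>\<in>overpartitions_upto k j. SOME_weight \<pi>) + ?w * int (card (overpartitions_upto k j))" for k j T
    proof -
      have "SOME_weight (add_mset (Suc m) P, T S) = ?w + SOME_weight (P, S)" for P S
        by (rule SOME_weight_add)
      then show ?thesis by (simp add: sum.distrib flip: case_prod_eta)
    qed
    then show "weight_gf (Suc m) $ n = (weight_gf m + fps_X ^ Suc m *
     (weight_gf (Suc m) + weight_gf m + fps_const ?w * (count_gf (Suc m) + count_gf m))) $ n"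
      using sum_overpartitions_upto_Suc[of SOME_weight m n]
      by (simp add: weight_gf_def count_gf_def fps_X_power_mult_nth algebra_simps
          del: power_Suc)
  qed
  then show ?thesis by (simp add: algebra_simps of_int_eq_fps_const del: power_Suc)
qed

section \<open>Substitutions and the derivation \<open>q d/dq\<close>\<close>

lemma numeral_mult_nth: "(numeral w * f :: int fps) $ n = numeral w * f $ n"
  by (simp add: numeral_fps_const)

text \<open>
  The substitutions \<open>q \<mapsto> -q\<close> and \<open>q \<mapsto> q^2\<close>. Both are ring homomorphisms, and together with
  the extraction of the even coefficients they are all that the dissections below need.
\<close>

definition flip :: "int fps \<Rightarrow> int fps" where
  "flip f = f oo (- fps_X)"

definition dilate :: "int fps \<Rightarrow> int fps" where
  "dilate f = f oo fps_X ^ 2"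

definition even_section :: "int fps \<Rightarrow> int fps" where
  "even_section f = Abs_fps (\<lambda>n. f $ (2 * n))"

lemma flip_nth: "flip f $ n = (-1) ^ n * f $ n"
  by (simp add: flip_def fps_compose_uminus')

lemma dilate_nth: "dilate f $ n = (if even n then f $ (n div 2) else 0)"
  by (simp add: dilate_def fps_nth_compose_X_power)

lemma even_section_nth [simp]: "even_section f $ n = f $ (2 * n)"
  by (simp add: even_section_def)

lemma flip_simps [simp]:
  "flip (f + g) = flip f + flip g" "flip (f - g) = flip f - flip g" "flip (- f) = - flip f"
  "flip (f * g) = flip f * flip g" "flip (f ^ k) = flip f ^ k" "flip 1 = 1"
  "flip (numeral w) = numeral w" "flip fps_X = - fps_X" "flip (flip f) = f"
  "flip (dilate f) = dilate f"
  by (simp_all add: flip_def fps_compose_add_distrib fps_compose_sub_distrib fps_compose_uminus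
      fps_compose_mult_distrib fps_compose_power)
     (simp_all add: fps_eq_iff flip_nth dilate_nth flip: flip_def fps_of_int)

lemma dilate_simps [simp]:
  "dilate (f + g) = dilate f + dilate g" "dilate (f - g) = dilate f - dilate g"
  "dilate (f * g) = dilate f * dilate g" "dilate (f ^ k) = dilate f ^ k" "dilate 1 = 1"
  "dilate (numeral w) = numeral w"
  by (simp_all add: dilate_def fps_compose_add_distrib fps_compose_sub_distrib
      fps_compose_mult_distrib fps_compose_power)

lemma dilate_even_section: "2 * dilate (even_section f) = f + flip f"
  by (rule fps_ext) (auto simp: dilate_nth flip_nth numeral_mult_nth)

lemma even_section_dilate [simp]: "even_section (dilate f) = f"
  by (rule fps_ext) (simp add: dilate_nth)

lemma dilate_inj: "dilate f = dilate g \<longleftrightarrow> f = g"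
  by (metis even_section_dilate)

text \<open>
  Series in \<open>q^2\<close> are scalars for the extraction of even coefficients. This is why
  denominators are made even before coefficients are extracted.
\<close>

lemma even_section_mult_dilate: "even_section (f * dilate g) = even_section f * g"
proof -
  have "2 * dilate (even_section (f * dilate g)) = 2 * dilate (even_section f * g)"
    unfolding dilate_simps by (simp add: dilate_even_section algebra_simps flip: mult.assoc)
  then have "dilate (even_section (f * dilate g)) = dilate (even_section f * g)"
    by (metis mult_cancel_left zero_neq_numeral)
  then show ?thesis by (simp only: dilate_inj)
qed

lemma XD_nth: "fps_XD f $ n = of_nat n * f $ n"
  by (cases n) (simp_all add: fps_XD_def)

lemma XD_mult: "fps_XD (f * g) = fps_XD f * g + f * fps_XD (g :: int fps)"
  by (simp add: fps_XD_def algebra_simps)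

lemma XD_diff: "fps_XD (f - g) = fps_XD f - fps_XD (g :: int fps)"
  by (simp add: fps_XD_def algebra_simps)

lemma XD_square: "fps_XD (f ^ 2) = 2 * f * fps_XD (f :: int fps)"
  by (simp add: power2_eq_square XD_mult)

lemma XD_one: "fps_XD (1 :: int fps) = 0"
  by (simp add: fps_XD_def)

lemma XD_two: "fps_XD (2 * f) = 2 * fps_XD (f :: int fps)"
  by (simp add: fps_XD_def)

lemma XD_flip: "fps_XD (flip f) = flip (fps_XD f)"
  by (rule fps_ext) (simp add: XD_nth flip_nth)

lemma XD_dilate: "fps_XD (dilate f) = 2 * dilate (fps_XD f)"
  by (rule fps_ext) (auto simp: XD_nth dilate_nth numeral_mult_nth)

lemma XD_X_power: "fps_XD (fps_X ^ n :: int fps) = of_nat n * fps_X ^ n"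
  by (rule fps_ext) (auto simp: XD_nth simp flip: fps_of_nat)

section \<open>The theta series \<open>\<phi>\<close> and its quadratic relations\<close>

definition phi :: "int fps" where
  "phi = Abs_fps (\<lambda>n. int (card {x :: int. x ^ 2 = int n}))"

lemma finite_square_roots: "finite {x :: int. x ^ 2 = int n}"
proof (rule finite_subset)
  show "{x :: int. x ^ 2 = int n} \<subseteq> {- int n..int n}"
  proof clarify
    fix x :: int assume "x ^ 2 = int n"
    moreover have "\<bar>x\<bar> \<le> \<bar>x\<bar> ^ 2"
      using self_le_power[of "\<bar>x\<bar>" 2] by (cases "x = 0") auto
    ultimately show "x \<in> {- int n..int n}" by auto
  qed
qed auto

lemma phi_nth: "phi $ n = (if n = 0 then 1 else if \<exists>m. n = m ^ 2 then 2 else 0)"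
proof -
  consider "n = 0" | m where "n = m ^ 2" "m > 0" | "\<not> (\<exists>m. n = m ^ 2)"
    by (metis gr0I zero_power2)
  then show ?thesis
  proof cases
    case 1
    then show ?thesis by (simp add: phi_def)
  next
    case (2 m)
    have "{x :: int. x ^ 2 = int n} = {int m, - int m}"
      using 2 by (auto simp: power2_eq_iff)
    then show ?thesis using 2 by (auto simp: phi_def)
  next
    case 3
    have "x ^ 2 \<noteq> int n" for x :: int
    proof
      assume "x ^ 2 = int n"
      then have "int (nat \<bar>x\<bar> ^ 2) = int n" by simp
      then show False using 3 by (metis of_nat_eq_iff)
    qed
    then have "{x :: int. x ^ 2 = int n} = {}" by auto
    moreover have "n \<noteq> 0" using 3 by (metis zero_power2)
    ultimately show ?thesis using 3 by (auto simp: phi_def)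
  qed
qed

text \<open>
  This is half of the odd part of \<open>\<phi>\<close>: each odd square has two roots.
\<close>

definition odd_squares :: "int fps" where
  "odd_squares = Abs_fps (\<lambda>n. if odd n \<and> (\<exists>m. n = m ^ 2) then 1 else 0)"

lemma phi_split: "phi = dilate (dilate phi) + 2 * odd_squares"
proof (rule fps_ext)
  fix n
  show "phi $ n = (dilate (dilate phi) + 2 * odd_squares) $ n"
  proof (cases "4 dvd n")
    case True
    then obtain k where k: "n = 4 * k" by auto
    have "(\<exists>m. 4 * k = m ^ 2) \<longleftrightarrow> (\<exists>m. k = m ^ 2)"
    proof
      assume "\<exists>m. 4 * k = m ^ 2"
      then obtain m where m: "4 * k = m ^ 2" by auto
      then have "even (m ^ 2)" by (metis dvd_triv_left even_mult_iff even_numeral)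
      then obtain l where "m = 2 * l" by auto
      then show "\<exists>m. k = m ^ 2" using m by (auto simp: power_mult_distrib)
    next
      assume "\<exists>m. k = m ^ 2"
      then obtain m where "k = m ^ 2" by auto
      then have "4 * k = (2 * m) ^ 2" by simp
      then show "\<exists>m. 4 * k = m ^ 2" by blast
    qed
    then show ?thesis
      using k by (simp add: dilate_nth odd_squares_def numeral_mult_nth phi_nth)
  next
    case False
    have odd: "odd n" if "n = m ^ 2" for m
    proof
      assume "even n"
      then have "even m" using that by simp
      then have "2 ^ 2 dvd m ^ 2" by (rule dvd_power_same)
      then show False using False that by simp
    qed
    have "\<not> (even n \<and> even (n div 2))" using False by (auto elim!: evenE)
    then show ?thesis
      using odd by (auto simp: dilate_nth odd_squares_def numeral_mult_nth phi_nth)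
  qed
qed

lemma flip_odd_squares: "flip odd_squares = - odd_squares"
  by (rule fps_ext) (simp add: flip_nth odd_squares_def)

lemma phi_sq_nth: "(phi ^ 2) $ n = int (card {(x :: int, y :: int). x ^ 2 + y ^ 2 = int n})"
proof -
  have "{(x :: int, y :: int). x ^ 2 + y ^ 2 = int n} =
      (\<Union>i\<in>{0..n}. {x. x ^ 2 = int i} \<times> {y. y ^ 2 = int (n - i)})"
  proof (rule set_eqI, clarify)
    fix x y :: int
    have "(x, y) \<in> (\<Union>i\<in>{0..n}. {x. x ^ 2 = int i} \<times> {y. y ^ 2 = int (n - i)})"
      if "x ^ 2 + y ^ 2 = int n"
    proof -
      have "x ^ 2 = int (nat (x ^ 2))" "y ^ 2 = int (n - nat (x ^ 2))" "nat (x ^ 2) \<le> n"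
        using that zero_le_power2[of x] zero_le_power2[of y] by linarith+
      then show ?thesis by (intro UN_I[where a = "nat (x ^ 2)"]) auto
    qed
    then show "(x, y) \<in> {(x, y). x ^ 2 + y ^ 2 = int n} \<longleftrightarrow>
      (x, y) \<in> (\<Union>i\<in>{0..n}. {x. x ^ 2 = int i} \<times> {y. y ^ 2 = int (n - i)})"
      by auto
  qed
  also have "card \<dots> =
      (\<Sum>i=0..n. card ({x :: int. x ^ 2 = int i} \<times> {y :: int. y ^ 2 = int (n - i)}))"
    by (rule card_UN_disjoint) (auto intro!: finite_cartesian_product finite_square_roots
        simp del: of_nat_diff)
  finally show ?thesis
    unfolding power2_eq_square[of phi] fps_mult_nth
    by (simp add: phi_def card_cartesian_product del: of_nat_diff)
qed

text \<open>
  The map \<open>(x, y) \<mapsto> (x + y, x - y)\<close> doubles \<open>x^2 + y^2\<close> and reaches every representation of an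
  even number, because there the two coordinates have the same parity.
\<close>

lemma even_section_phi_sq: "even_section (phi ^ 2) = phi ^ 2"
proof (rule fps_ext)
  fix n
  have "bij_betw (\<lambda>(x, y). (x + y, x - y)) {(x :: int, y :: int). x ^ 2 + y ^ 2 = int n}
     {(x :: int, y :: int). x ^ 2 + y ^ 2 = int (2 * n)}"
  proof (rule bij_betwI[where g = "\<lambda>(x, y). ((x + y) div 2, (x - y) div 2)"])
    show "(\<lambda>(x, y). ((x + y) div 2, (x - y) div 2)) \<in>
      {(x :: int, y :: int). x ^ 2 + y ^ 2 = int (2 * n)} \<rightarrow> {(x, y). x ^ 2 + y ^ 2 = int n}"
    proof clarsimp
      fix x y :: int assume e: "x ^ 2 + y ^ 2 = 2 * int n"
      then have "even (x ^ 2 + y ^ 2)" by simp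
      then have "even (x + y)" by simp
      then obtain s where s: "x + y = 2 * s" by (rule evenE)
      then have "x - y = 2 * (s - y)" by simp
      then have halves: "(x + y) div 2 = s" "(x - y) div 2 = s - y" using s by simp_all
      have "x = 2 * s - y" using s by simp
      then have "(2 * s - y) ^ 2 + y ^ 2 = 2 * int n" using e by simp
      then show "((x + y) div 2)\<^sup>2 + ((x - y) div 2)\<^sup>2 = int n"
        unfolding halves by (simp add: power2_eq_square algebra_simps)
    qed
    show "(case case p of (x, y) \<Rightarrow> ((x + y) div 2, (x - y) div 2) of (x, y) \<Rightarrow> (x + y, x - y)) = p"
      if "p \<in> {(x :: int, y :: int). x ^ 2 + y ^ 2 = int (2 * n)}" for p
    proof -
      obtain x y where p: "p = (x, y)" by force
      have "even (x ^ 2 + y ^ 2)" using that p by simp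
      then have "even (x + y)" by simp
      then have "(x + y) div 2 + (x - y) div 2 = x" "(x + y) div 2 - (x - y) div 2 = y"
        by presburger+
      then show ?thesis using p by simp
    qed
  qed (auto simp: power2_eq_square algebra_simps)
  then have "card {(x :: int, y :: int). x ^ 2 + y ^ 2 = int n} =
     card {(x :: int, y :: int). x ^ 2 + y ^ 2 = int (2 * n)}"
    by (rule bij_betw_same_card)
  then show "even_section (phi ^ 2) $ n = phi ^ 2 $ n" by (simp add: phi_sq_nth)
qed

lemma phi_add_flip: "phi + flip phi = 2 * dilate (dilate phi)"
  by (subst (1 2) phi_split) (simp add: flip_odd_squares)

lemma phi_diff_flip: "phi - flip phi = 4 * odd_squares"
  by (subst (1 2) phi_split) (simp add: flip_odd_squares)

lemma phi_sq_add: "phi ^ 2 + flip phi ^ 2 = 2 * dilate phi ^ 2"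
  using dilate_even_section[of "phi ^ 2"] by (simp add: even_section_phi_sq)

text \<open>
  Squaring \<open>a + b = 2 a2\<close> and subtracting \<open>a^2 + b^2 = 2 a1^2\<close> leaves \<open>a b = 2 a2^2 - a1^2\<close>, which
  equals \<open>b1^2\<close> by the second relation with \<open>q^2\<close> in place of \<open>q\<close>.
\<close>

lemma phi_mult_flip: "phi * flip phi = dilate (flip phi) ^ 2"
proof -
  have "dilate (phi ^ 2 + flip phi ^ 2) = dilate (2 * dilate phi ^ 2)"
    by (simp only: phi_sq_add)
  then have 1: "dilate phi ^ 2 + dilate (flip phi) ^ 2 = 2 * dilate (dilate phi) ^ 2" by simp
  have 2: "(phi + flip phi) ^ 2 = 4 * dilate (dilate phi) ^ 2"
    by (simp add: phi_add_flip power_mult_distrib)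
  have "2 * (phi * flip phi) = 2 * dilate (flip phi) ^ 2"
    using 1 2 phi_sq_add by algebra
  then show ?thesis by simp
qed

section \<open>The weighted count as a logarithmic derivative\<close>

lemma one_pm_X_power_neq_0:
  "(1 - fps_X ^ Suc m :: int fps) \<noteq> 0" "(1 + fps_X ^ Suc m :: int fps) \<noteq> 0"
  by (auto simp: fps_eq_iff intro!: exI[of _ 0])

text \<open>
  Adding the part size \<open>m\<close> multiplies \<open>c\<close> by \<open>(1 + q^m) / (1 - q^m)\<close> and adds
  \<open>\<plusminus> 2 m q^m / (1 - q^(2 m))\<close> to \<open>W/c\<close>, where \<open>W\<close> is the weighted generating function and the sign
  is + for odd \<open>m\<close>. The logarithmic derivative of the factor is \<open>2 m q^m / (1 - q^(2 m))\<close>, and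
  \<open>q \<mapsto> -q\<close> changes its sign exactly for odd \<open>m\<close>. So \<open>W/c\<close> and the logarithmic derivative of
  \<open>c(-q)\<close> are negatives of each other.
\<close>

lemma weight_gf_eq:
  "weight_gf m * flip (count_gf m) = - count_gf m * fps_XD (flip (count_gf m))"
proof (induction m)
  case 0
  then show ?case by (simp add: weight_gf_0 count_gf_0 XD_one)
next
  case (Suc m)
  define u :: "int fps" where "u = fps_X ^ Suc m"
  define k :: "int fps" where "k = of_nat (Suc m)"
  define c c' d d' D D' W W' where "c = count_gf m" and "c' = count_gf (Suc m)"
    and "d = flip c" and "d' = flip c'" and "D = fps_XD d" and "D' = fps_XD d'"
    and "W = weight_gf m" and "W' = weight_gf (Suc m)"
  note defs = c_def c'_def d_def d'_def D_def D'_def W_def W'_def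
  have c: "c' * (1 - u) = c * (1 + u)"
    using count_gf_Suc[of m] unfolding u_def c_def c'_def .
  have IH: "W * d = - c * D" using Suc.IH unfolding defs .
  have Du: "fps_XD u = k * u" unfolding u_def k_def by (rule XD_X_power)
  have XD_pm: "fps_XD (1 - u) = - (k * u)" "fps_XD (1 + u) = k * u"
    using Du by (simp_all add: XD_diff XD_one)
  show ?case
  proof (cases "even (Suc m)")
    case True
    then have fu: "flip u = u" by (simp add: u_def)
    have d: "d' * (1 - u) = d * (1 + u)"
      using arg_cong[OF c, of flip] by (simp add: d_def d'_def fu)
    have D: "D' * (1 - u) - k * u * d' = D * (1 + u) + k * u * d"
      using arg_cong[OF d, of fps_XD] unfolding XD_mult XD_pm D_def D'_def by algebra
    have "of_int (signed_part (Suc m)) = - k" using True by (simp add: signed_part_def k_def)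
    then have W: "W' * (1 - u) = W * (1 + u) + - k * u * (c' + c)"
      using weight_gf_Suc[of m] unfolding W_def W'_def u_def c_def c'_def by simp
    \<comment> \<open>each product has two primed factors, and each needs one \<open>1 - u\<close> for its recurrence\<close>
    have "(1 - u) ^ 2 * (W' * d' + c' * D') = 0"
      using c d D W IH by algebra
    then have "W' * d' + c' * D' = 0"
      using one_pm_X_power_neq_0(1)[of m] unfolding u_def by simp
    then show ?thesis by (simp add: defs eq_neg_iff_add_eq_0)
  next
    case False
    then have fu: "flip u = - u" by (simp add: u_def)
    have d: "d' * (1 + u) = d * (1 - u)"
      using arg_cong[OF c, of flip] by (simp add: d_def d'_def fu)
    have D: "D' * (1 + u) + k * u * d' = D * (1 - u) - k * u * d"
      using arg_cong[OF d, of fps_XD] unfolding XD_mult XD_pm D_def D'_def by algebra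
    have "of_int (signed_part (Suc m)) = k" using False by (simp add: signed_part_def k_def)
    then have W: "W' * (1 - u) = W * (1 + u) + k * u * (c' + c)"
      using weight_gf_Suc[of m] unfolding W_def W'_def u_def c_def c'_def by simp
    have "((1 - u) * (1 + u)) * (W' * d' + c' * D') = 0"
      using c d D W IH by algebra
    then have "W' * d' + c' * D' = 0"
      using one_pm_X_power_neq_0[of m] unfolding u_def by simp
    then show ?thesis by (simp add: defs eq_neg_iff_add_eq_0)
  qed
qed

section \<open>Gauss's identity for the generating function of overpartitions\<close>

definition alternating_squares :: "nat \<Rightarrow> int fps" where
  "alternating_squares n = 1 + 2 * (\<Sum>s=1..n. (-1) ^ s * fps_X ^ (s ^ 2))"

text \<open>
  The recurrence between consecutive \<open>c_s\<close> gives \<open>(c_s + c_(s-1)) (1 - q^s) = 2 c_(s-1)\<close> and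
  \<open>(c_s + c_(s-1)) (1 + q^s) = 2 c_s\<close>, where \<open>c_s\<close> is \<open>count_gf s\<close>. Thus the \<open>s\<close>-th summand is
  \<open>2 (-1)^s (u^s c_(s-1) + u^(s+1) c_s)\<close>, which telescopes.
\<close>

lemma telescope_step:
  "(\<Sum>s=1..n. (-1) ^ s * (count_gf s + count_gf (s - 1)) *
      (u ^ s * ((1 - fps_X ^ s) + u * (1 + fps_X ^ s)))) =
   2 * ((-1) ^ n * u ^ Suc n * count_gf n - u)"
proof (induction n)
  case 0
  then show ?case by (simp add: count_gf_0)
next
  case (Suc n)
  have "(count_gf (Suc n) + count_gf n) * (1 - fps_X ^ Suc n) = 2 * count_gf n"
       "(count_gf (Suc n) + count_gf n) * (1 + fps_X ^ Suc n) = 2 * count_gf (Suc n)"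
    using count_gf_Suc[of n] by (simp_all add: algebra_simps del: power_Suc)
  moreover have "C * (v * (p + u * q)) = v * (C * p + u * (C * q))" for C v p q :: "int fps"
    by (simp add: algebra_simps)
  ultimately have "(count_gf (Suc n) + count_gf n) *
      (u ^ Suc n * ((1 - fps_X ^ Suc n) + u * (1 + fps_X ^ Suc n))) =
      u ^ Suc n * (2 * count_gf n + u * (2 * count_gf (Suc n)))"
    by metis
  then have "(-1) ^ Suc n * (count_gf (Suc n) + count_gf (Suc n - 1)) *
      (u ^ Suc n * ((1 - fps_X ^ Suc n) + u * (1 + fps_X ^ Suc n))) =
      (-1) ^ Suc n * (u ^ Suc n * (2 * count_gf n + u * (2 * count_gf (Suc n))))"
    by (simp only: mult.assoc diff_Suc_1)
  moreover have "1 \<le> Suc (Suc n)" by simp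
  ultimately show ?case
    by (simp only: sum.nat_ivl_Suc' Suc.IH) (simp add: algebra_simps)
qed

text \<open>
  A finite form of Gauss's identity, in the style of Shanks: the partial sums of \<open>\<phi>(-q)\<close> times
  the partial products of the overpartition generating function equal 1 up to an error
  that starts only at \<open>q^(n+1)\<close>. Multiplied by \<open>1 - q^(n+1)\<close>, the induction step reduces to the
  telescoping sum above with \<open>u = q^(n+1)\<close>.
\<close>

lemma count_gf_mult_alternating_squares:
  "count_gf n * alternating_squares n =
     1 + (\<Sum>s=1..n. (-1) ^ s * fps_X ^ (s * Suc n) * (count_gf s + count_gf (s - 1)))"
proof (induction n)
  case 0
  then show ?case by (simp add: count_gf_0 alternating_squares_def)
next
  case (Suc n)
  define x :: "int fps" where "x = fps_X ^ Suc n"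
  define d where "d s = (-1) ^ s * (count_gf s + count_gf (s - 1))" for s
  define R R' where "R = (\<Sum>s=1..n. x ^ s * d s)"
    and "R' = (\<Sum>s=1..n. fps_X ^ s * x ^ s * d s)"
  have pow: "fps_X ^ (s * Suc n) = x ^ s" "fps_X ^ (s * Suc (Suc n)) = fps_X ^ s * x ^ s" for s
    by (simp_all add: x_def mult.commute flip: power_mult power_add del: power_Suc mult_Suc)
  have R: "(\<Sum>s=1..n. (-1) ^ s * fps_X ^ (s * Suc n) * (count_gf s + count_gf (s - 1))) = R"
    unfolding R_def d_def pow by (simp add: ac_simps)
  have R': "(\<Sum>s=1..Suc n. (-1) ^ s * fps_X ^ (s * Suc (Suc n)) * (count_gf s + count_gf (s - 1))) =
      R' + x * x ^ Suc n * d (Suc n)"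
    unfolding R'_def d_def pow by (simp add: ac_simps x_def[symmetric] del: power_Suc)
  have "(1 + x) * R - (1 - x) * R' = (\<Sum>s=1..n. (-1) ^ s * (count_gf s + count_gf (s - 1)) *
      (x ^ s * ((1 - fps_X ^ s) + x * (1 + fps_X ^ s))))"
    unfolding R_def R'_def d_def sum_distrib_left sum_subtractf[symmetric]
    by (intro sum.cong refl) (simp add: algebra_simps)
  then have tel: "(1 + x) * R - (1 - x) * R' = 2 * ((-1) ^ n * x ^ Suc n * count_gf n - x)"
    unfolding telescope_step .
  have A: "alternating_squares (Suc n) = alternating_squares n + 2 * (-1) ^ Suc n * x ^ Suc n"
    by (simp add: alternating_squares_def x_def power2_eq_square algebra_simps
        flip: power_mult power_add)
  have c: "count_gf (Suc n) * (1 - x) = count_gf n * (1 + x)"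
    unfolding x_def by (rule count_gf_Suc)
  have d: "d (Suc n) = (-1) ^ Suc n * (count_gf (Suc n) + count_gf n)" by (simp add: d_def)
  define e :: "int fps" where "e = (-1) ^ n"
  define z where "z = x ^ Suc n"
  have e: "(-1) ^ Suc n = - e" by (simp add: e_def)
  have IH: "count_gf n * alternating_squares n = 1 + R" using Suc.IH R by simp
  have "(1 - x) * (count_gf (Suc n) * alternating_squares (Suc n)) =
        (1 - x) * (1 + (R' + x * x ^ Suc n * d (Suc n)))"
    using tel c IH unfolding A d e e_def[symmetric] z_def[symmetric] by algebra
  then have "count_gf (Suc n) * alternating_squares (Suc n) = 1 + (R' + x * x ^ Suc n * d (Suc n))"
    using one_pm_X_power_neq_0(1)[of n] unfolding x_def by (metis mult_cancel_left)
  then show ?case unfolding R' .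
qed

text \<open>
  Equality modulo \<open>q^(N+1)\<close>, used to pass from bounded to unbounded parts.
\<close>

definition agree :: "nat \<Rightarrow> int fps \<Rightarrow> int fps \<Rightarrow> bool" where
  "agree N f g \<longleftrightarrow> (\<forall>i\<le>N. f $ i = g $ i)"

lemma agree_intros:
  "agree N f f"
  "agree N f f' \<Longrightarrow> agree N g g' \<Longrightarrow> agree N (f * g) (f' * g')"
  "agree N f f' \<Longrightarrow> agree N (- f) (- f')"
  "agree N f f' \<Longrightarrow> agree N (flip f) (flip f')"
  "agree N f f' \<Longrightarrow> agree N (fps_XD f) (fps_XD f')"
  by (auto simp: agree_def fps_mult_nth flip_nth XD_nth)

lemma agree_nth: "agree N f g \<Longrightarrow> f $ N = g $ N"
  by (simp add: agree_def)

definition overpartition_gf :: "int fps" where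
  "overpartition_gf = Abs_fps (\<lambda>n. int (card (overpartitions n)))"

definition SOME_gf :: "int fps" where
  "SOME_gf = Abs_fps SOME_overline"

lemma agree_count_gf: "agree N (count_gf N) overpartition_gf"
  by (simp add: agree_def count_gf_def overpartition_gf_def overpartitions_upto_self)

lemma agree_weight_gf: "agree N (weight_gf N) SOME_gf"
  by (simp add: agree_def weight_gf_def SOME_gf_def SOME_overline_def SOME_weight_def
      overpartitions_upto_self)

lemma minus_one_power_mult_nth: "((-1) ^ s * f :: int fps) $ i = (-1) ^ s * f $ i"
  by (cases "even s") auto

lemma agree_alternating_squares: "agree N (alternating_squares N) (flip phi)"
  unfolding agree_def
proof (intro allI impI)
  fix i assume i: "i \<le> N"
  have nth: "alternating_squares N $ i =
      (if i = 0 then 1 else 0) + 2 * (\<Sum>s=1..N. if s ^ 2 = i then (-1) ^ s else 0)"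
    by (auto simp: alternating_squares_def numeral_mult_nth fps_sum_nth
        minus_one_power_mult_nth intro!: sum.cong)
  show "alternating_squares N $ i = flip phi $ i"
  proof (cases "\<exists>m>0. i = m ^ 2")
    case True
    then obtain m where m: "m > 0" "i = m ^ 2" by auto
    have "m \<le> m ^ 2" using m(1) by (simp add: power2_eq_square)
    then have "m \<in> {1..N}" using i m by simp
    have "(\<Sum>s=1..N. if s ^ 2 = i then (-1) ^ s else 0 :: int) =
        (\<Sum>s=1..N. if s = m then (-1) ^ s else 0)"
      by (intro sum.cong) (auto simp: m power2_eq_iff)
    also have "\<dots> = (-1) ^ m" using \<open>m \<in> {1..N}\<close> by simp
    finally show ?thesis using m unfolding nth
      by (auto simp: flip_nth phi_nth minus_one_power_iff)
  next
    case False
    have "s ^ 2 \<noteq> i" if "s \<in> {1..N}" for s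
    proof
      assume "s ^ 2 = i"
      then have "\<exists>m>0. i = m ^ 2" using that by (intro exI[of _ s]) auto
      then show False using False by contradiction
    qed
    then have "(\<Sum>s=1..N. if s ^ 2 = i then (-1) ^ s else 0 :: int) = 0"
      by (intro sum.neutral) simp
    moreover have "i = 0 \<or> \<not> (\<exists>m. i = m ^ 2)" using False by (metis gr0I zero_power2)
    ultimately show ?thesis unfolding nth by (auto simp: flip_nth phi_nth)
  qed
qed

lemma overpartition_gf_mult_flip_phi: "overpartition_gf * flip phi = 1"
proof (rule fps_ext)
  fix N
  have "(overpartition_gf * flip phi) $ N = (count_gf N * alternating_squares N) $ N"
    by (intro agree_nth[symmetric] agree_intros agree_count_gf agree_alternating_squares)
  also have "\<dots> = 1 $ N"
  proof -
    have "((-1) ^ s * fps_X ^ (s * Suc N) * f :: int fps) $ N = 0" if "s \<ge> 1" for s f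
      using that by (cases s) (simp_all add: mult.assoc minus_one_power_mult_nth fps_X_power_mult_nth
          del: power_Suc)
    then show ?thesis unfolding count_gf_mult_alternating_squares by (simp add: fps_sum_nth)
  qed
  finally show "(overpartition_gf * flip phi) $ N = 1 $ N" .
qed

section \<open>The generating function of the weighted sums\<close>

text \<open>
  Let \<open>n \<rightarrow> \<infinity>\<close> in the logarithmic derivative formula and substitute \<open>P = 1/b\<close>, \<open>P(-q) = 1/a\<close>.
\<close>

lemma SOME_gf_eq: "SOME_gf * (phi * flip phi) = fps_XD phi"
proof -
  let ?P = overpartition_gf
  have P: "?P * flip phi = 1" by (rule overpartition_gf_mult_flip_phi)
  from arg_cong[OF P, of flip] have P': "flip ?P * phi = 1" by simp
  from arg_cong[OF P', of fps_XD] have dP: "fps_XD (flip ?P) * phi + flip ?P * fps_XD phi = 0"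
    by (simp add: XD_mult XD_one)
  have "SOME_gf * flip ?P = - ?P * fps_XD (flip ?P)"
  proof (rule fps_ext)
    fix N
    have "(SOME_gf * flip ?P) $ N = (weight_gf N * flip (count_gf N)) $ N"
      by (intro agree_nth[symmetric] agree_intros agree_count_gf agree_weight_gf)
    also have "\<dots> = (- ?P * fps_XD (flip ?P)) $ N"
      unfolding weight_gf_eq by (intro agree_nth agree_intros agree_count_gf)
    finally show "(SOME_gf * flip ?P) $ N = (- ?P * fps_XD (flip ?P)) $ N" .
  qed
  then show ?thesis using P P' dP by algebra
qed

definition SOME_even_gf :: "int fps" where
  "SOME_even_gf = even_section SOME_gf"

text \<open>
  In \<open>S = \<theta>a / (a b)\<close> the denominator is \<open>b1^2\<close>, a series in \<open>q^2\<close>, and the even part of \<open>\<phi>(q)\<close> is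
  \<open>\<phi>(q^4)\<close>. The factor 2 comes from the chain rule \<open>\<theta>(f(q^2)) = 2 (\<theta>f)(q^2)\<close>.
\<close>

lemma SOME_even_gf_eq: "SOME_even_gf * flip phi ^ 2 = 2 * fps_XD (dilate phi)"
proof -
  have "2 * dilate (even_section (fps_XD phi)) = fps_XD (phi + flip phi)"
    by (simp add: dilate_even_section XD_flip)
  also have "\<dots> = 2 * dilate (2 * fps_XD (dilate phi))"
    by (simp add: phi_add_flip XD_two XD_dilate)
  finally have "even_section (fps_XD phi) = 2 * fps_XD (dilate phi)"
    by (metis dilate_inj mult_cancel_left zero_neq_numeral)
  moreover have "even_section (SOME_gf * (phi * flip phi)) = SOME_even_gf * flip phi ^ 2"
    unfolding phi_mult_flip SOME_even_gf_def
    by (metis dilate_simps(4) even_section_mult_dilate)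
  ultimately show ?thesis by (simp add: SOME_gf_eq)
qed

section \<open>The Wronskian identity\<close>

lemma subdegree_dilate: "subdegree (dilate f) = 2 * subdegree f"
proof (cases "f = 0")
  case True
  then show ?thesis by (simp add: dilate_def)
next
  case False
  then show ?thesis
    by (intro subdegreeI) (auto simp: dilate_nth intro: nth_less_subdegree_zero elim!: evenE)
qed

text \<open>
  If \<open>D\<close> has order \<open>d\<close>, the two sides have orders \<open>2 d\<close> and \<open>d + 1\<close>, so \<open>d = 1\<close>.
\<close>

lemma dilate_equation_unique:
  assumes eq: "f * dilate D = g * D" and f: "f $ 0 \<noteq> 0" and g: "subdegree g = 1"
    and D1: "D $ 1 = 0"
  shows "D = 0"
proof (rule ccontr)
  assume D: "D \<noteq> 0"
  have "f \<noteq> 0" "g \<noteq> 0" using f g by auto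
  moreover have "dilate D \<noteq> 0" using D dilate_inj[of D 0] by (simp add: dilate_def)
  ultimately have "subdegree f + 2 * subdegree D = 1 + subdegree D"
    using arg_cong[OF eq, of subdegree] D g by (simp add: subdegree_dilate)
  moreover have "subdegree f = 0" using f by auto
  ultimately have "subdegree D = 1" by simp
  then show False using D1 D nth_subdegree_nonzero by metis
qed

lemma XD_phi_sq_add:
  "phi * fps_XD phi + flip phi * fps_XD (flip phi) = 4 * dilate phi * dilate (fps_XD phi)"
proof -
  have "2 * (phi * fps_XD phi + flip phi * fps_XD (flip phi)) =
      2 * (4 * dilate phi * dilate (fps_XD phi))"
    using arg_cong[OF phi_sq_add, of fps_XD]
    by (simp add: XD_two XD_square XD_dilate algebra_simps)
  then show ?thesis by (metis mult_cancel_left zero_neq_numeral)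
qed

lemma XD_phi_mult_flip:
  "fps_XD phi * flip phi + phi * fps_XD (flip phi) =
     4 * dilate (flip phi) * dilate (fps_XD (flip phi))"
  using arg_cong[OF phi_mult_flip, of fps_XD] by (simp add: XD_mult XD_square XD_dilate)

lemma phi_nth_01: "phi $ 0 = 1" "phi $ Suc 0 = 2" "flip phi $ 0 = 1" "flip phi $ Suc 0 = - 2"
  by (auto simp: phi_nth flip_nth intro: exI[of _ 1])

lemma odd_squares_nth_01: "odd_squares $ 0 = 0" "odd_squares $ Suc 0 = 1"
  by (auto simp: odd_squares_def intro: exI[of _ 1])

lemma phi_sq_diff: "phi ^ 2 - flip phi ^ 2 = 8 * dilate (dilate phi) * odd_squares"
  using phi_add_flip phi_diff_flip by algebra

text \<open>
  Both sides satisfy the functional equation \<open>8 a1 b1 D(q^2) = (a^2 - b^2) D(q)\<close>: for the right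
  side this uses the quadratic relations, for the left side also their derivatives. Since
  \<open>a^2 - b^2\<close> starts with \<open>8 q\<close>, a solution is determined by its coefficient of \<open>q\<close>, and both
  sides start with \<open>16 q\<close>. Equivalently, the ratio of the two sides is invariant under
  \<open>q \<mapsto> q^2\<close> and therefore constant.
\<close>

lemma wronskian_phi:
  "4 * (flip phi * fps_XD phi - phi * fps_XD (flip phi)) =
     phi * flip phi * (phi ^ 4 - flip phi ^ 4)"
proof -
  define a b A B where "a = phi" and "b = flip phi" and "A = fps_XD phi" and "B = fps_XD (flip phi)"
  define a1 b1 A1 B1 where "a1 = dilate a" and "b1 = dilate b" and "A1 = dilate A" and "B1 = dilate B"
  define D where "D = 4 * (b * A - a * B) - a * b * (a ^ 4 - b ^ 4)"
  note defs = a_def b_def A_def B_def a1_def b1_def A1_def B1_def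
  have rel: "a ^ 2 + b ^ 2 = 2 * a1 ^ 2" "a * b = b1 ^ 2"
     "a * A + b * B = 4 * a1 * A1" "A * b + a * B = 4 * b1 * B1"
    unfolding defs
    by (rule phi_sq_add phi_mult_flip XD_phi_sq_add XD_phi_mult_flip)+
  have dD: "dilate D = 4 * (b1 * A1 - a1 * B1) - a1 * b1 * (a1 ^ 4 - b1 ^ 4)"
    by (simp add: D_def a1_def b1_def A1_def B1_def)
  have left: "8 * (a1 * b1) * (4 * (b1 * A1 - a1 * B1)) = (a ^ 2 - b ^ 2) * (4 * (b * A - a * B))"
    using rel by algebra
  have right: "8 * (a1 * b1) * (a1 * b1 * (a1 ^ 4 - b1 ^ 4)) =
      (a ^ 2 - b ^ 2) * (a * b * (a ^ 4 - b ^ 4))"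
    using rel(1,2) by algebra
  have "8 * (a1 * b1) * dilate D =
      8 * (a1 * b1) * (4 * (b1 * A1 - a1 * B1)) - 8 * (a1 * b1) * (a1 * b1 * (a1 ^ 4 - b1 ^ 4))"
    unfolding dD by (rule right_diff_distrib)
  also have "\<dots> = (a ^ 2 - b ^ 2) * D"
    unfolding left right D_def by (rule right_diff_distrib[symmetric])
  also have "\<dots> = 8 * (dilate (dilate phi) * odd_squares) * D"
    unfolding a_def b_def phi_sq_diff by (simp add: mult.assoc)
  finally have "8 * (a1 * b1 * dilate D) = 8 * (dilate (dilate phi) * odd_squares * D)"
    by (simp only: mult.assoc)
  then have eq: "a1 * b1 * dilate D = dilate (dilate phi) * odd_squares * D"
    by (rule mult_left_cancel[THEN iffD1, rotated]) simp
  have "D = 0"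
  proof (rule dilate_equation_unique[OF eq])
    show "(a1 * b1) $ 0 \<noteq> 0" by (simp add: defs dilate_nth phi_nth_01)
    show "subdegree (dilate (dilate phi) * odd_squares) = 1"
      by (rule subdegreeI)
         (simp_all add: fps_mult_nth_1 dilate_nth phi_nth_01 odd_squares_nth_01)
    show "D $ 1 = 0"
      by (simp add: D_def a_def b_def A_def B_def eval_nat_numeral fps_mult_nth_1 phi_nth_01
          XD_nth numeral_mult_nth)
  qed
  then show ?thesis by (simp add: D_def a_def b_def A_def B_def)
qed

section \<open>Splitting off a derivative\<close>

definition remainder_gf :: "int fps" where
  "remainder_gf = dilate phi * phi ^ 2 * (phi ^ 2 - flip phi ^ 2) * overpartition_gf ^ 2"

text \<open>
  Differentiating \<open>a1/b^2\<close> gives \<open>\<theta>(a1)/b^2 - 2 a1 \<theta>b / b^3\<close>. The derivative of \<open>a^2 + b^2 = 2 a1^2\<close>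
  and the Wronskian identity express \<open>\<theta>b\<close> through \<open>\<theta>(a1)\<close>, namely
  \<open>\<theta>b / b = \<theta>(a1) / a1 - a^2 (a^2 - b^2) / 4\<close>.
  Hence \<open>\<theta>(a1/b^2) = - \<theta>(a1)/b^2 + a1 a^2 (a^2 - b^2) / (2 b^2)\<close>.
\<close>

lemma SOME_even_gf_decomp:
  "SOME_even_gf = - 2 * fps_XD (dilate phi * overpartition_gf ^ 2) + remainder_gf"
proof -
  define a b A B a1 E P Q where "a = phi" and "b = flip phi" and "A = fps_XD phi"
    and "B = fps_XD (flip phi)" and "a1 = dilate phi" and "E = fps_XD (dilate phi)"
    and "P = overpartition_gf" and "Q = fps_XD overpartition_gf"
  note defs = a_def b_def A_def B_def a1_def E_def P_def Q_def
  have rel: "a ^ 2 + b ^ 2 = 2 * a1 ^ 2" "a * A + b * B = 2 * a1 * E"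
    "4 * (b * A - a * B) = a * b * (a ^ 4 - b ^ 4)" "P * b = 1"
    unfolding defs using phi_sq_add XD_phi_sq_add wronskian_phi overpartition_gf_mult_flip_phi
    by (simp_all add: XD_dilate)
  have S: "SOME_even_gf * b ^ 2 = 2 * E" unfolding defs by (rule SOME_even_gf_eq)
  have Q: "Q * b + P * B = 0"
    using arg_cong[OF rel(4), of fps_XD] by (simp add: defs XD_mult XD_one)
  \<comment> \<open>the relations determine \<open>E\<close> only after multiplication by \<open>a1\<close>\<close>
  have "2 * a1 * (4 * b * E - 4 * a1 * B - a1 * a ^ 2 * b * (a ^ 2 - b ^ 2)) = 0"
    using rel(1-3) by algebra
  moreover have "a1 \<noteq> 0"
    using phi_nth_01(1) by (auto simp: a1_def dilate_nth dest: arg_cong[of _ _ "\<lambda>f. f $ 0"])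
  ultimately have "4 * b * E - 4 * a1 * B - a1 * a ^ 2 * b * (a ^ 2 - b ^ 2) = 0"
    by (metis mult_eq_0_iff zero_neq_numeral)
  then have "SOME_even_gf =
      - 2 * (E * P ^ 2 + a1 * (2 * P * Q)) + a1 * a ^ 2 * (a ^ 2 - b ^ 2) * P ^ 2"
    using S Q rel(4) by algebra
  then show ?thesis by (simp add: remainder_gf_def defs XD_mult XD_square)
qed

lemma overpartition_gf_dilate: "overpartition_gf = phi * dilate overpartition_gf ^ 2"
proof -
  have "dilate overpartition_gf * dilate (flip phi) = 1"
    using overpartition_gf_mult_flip_phi by (metis dilate_simps(3,5))
  then show ?thesis
    using overpartition_gf_mult_flip_phi phi_mult_flip by algebra
qed

text \<open>
  The even part of the remainder without its constant factor. Note that \<open>overpartition_gf\<close> is \<open>1/b\<close>.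
\<close>

definition core_gf :: "int fps" where
  "core_gf = phi ^ 3 * dilate phi ^ 2 * dilate (dilate phi) * odd_squares * overpartition_gf ^ 4"

text \<open>
  Since \<open>1/b^2 = a^2/b1^4\<close>, the remainder is \<open>a^4 (a^2 - b^2)\<close> times a series in \<open>q^2\<close>. Twice the
  even part of that factor is \<open>(a^4 - b^4) (a^2 - b^2) = 2 a1^2 (a^2 - b^2)^2\<close>, and
  \<open>(a^2 - b^2)^2 = 4 (a1^4 - b1^4)\<close> is again a series in \<open>q^2\<close>. What remains is
  \<open>4 a^3 (a^4 - b^4) / b^4\<close>, in which \<open>a^4 - b^4 = 2 a1^2 * 8 a2 c\<close>.
\<close>

lemma even_section_remainder_gf: "even_section remainder_gf = 64 * core_gf"
proof -
  define a b a1 b1 P where "a = phi" and "b = flip phi" and "a1 = dilate phi"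
    and "b1 = dilate (flip phi)" and "P = overpartition_gf"
  have rel: "a ^ 2 + b ^ 2 = 2 * a1 ^ 2" "a * b = b1 ^ 2"
    "a ^ 2 - b ^ 2 = 8 * dilate (dilate phi) * odd_squares"
    unfolding a_def b_def a1_def b1_def by (rule phi_sq_add phi_mult_flip phi_sq_diff)+
  have "2 * dilate (even_section (a ^ 4 * (a ^ 2 - b ^ 2))) =
      a ^ 4 * (a ^ 2 - b ^ 2) + b ^ 4 * (b ^ 2 - a ^ 2)"
    by (simp add: dilate_even_section a_def b_def)
  also have "\<dots> = 2 * (4 * a1 ^ 2 * (a1 ^ 4 - b1 ^ 4))" using rel by algebra
  also have "\<dots> = 2 * dilate (4 * a ^ 2 * (a ^ 4 - b ^ 4))"
    by (simp add: a_def b_def a1_def b1_def)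
  finally have es: "even_section (a ^ 4 * (a ^ 2 - b ^ 2)) = 4 * a ^ 2 * (a ^ 4 - b ^ 4)"
    by (metis dilate_inj mult_cancel_left zero_neq_numeral)
  have "P ^ 2 = a ^ 2 * dilate P ^ 4"
    unfolding P_def a_def
    by (subst overpartition_gf_dilate) (simp add: power_mult_distrib flip: power_mult)
  moreover have "remainder_gf = a1 * a ^ 2 * (a ^ 2 - b ^ 2) * P ^ 2"
    unfolding remainder_gf_def a_def b_def a1_def P_def ..
  moreover have "dilate (a * P ^ 4) = a1 * dilate P ^ 4"
    by (simp add: a1_def a_def)
  ultimately have "remainder_gf = a ^ 4 * (a ^ 2 - b ^ 2) * dilate (a * P ^ 4)"
    by algebra
  then have "even_section remainder_gf =
      even_section (a ^ 4 * (a ^ 2 - b ^ 2) * dilate (a * P ^ 4))"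
    by (rule arg_cong)
  also have "\<dots> = 4 * a ^ 2 * (a ^ 4 - b ^ 4) * (a * P ^ 4)"
    unfolding even_section_mult_dilate es ..
  also have "\<dots> = 64 * core_gf"
    using rel(1,3) unfolding core_gf_def a_def[symmetric] P_def[symmetric]
    unfolding a1_def a_def[symmetric] by algebra
  finally show ?thesis .
qed

section \<open>Congruences\<close>

lemma numeral_dvd_nth: "numeral w dvd (f :: int fps) \<Longrightarrow> numeral w dvd f $ n"
  by (auto simp: dvd_def numeral_mult_nth)

lemma phi_mod_2: obtains t where "phi = 1 + 2 * t"
proof
  show "phi = 1 + 2 * Abs_fps (\<lambda>n. if n \<noteq> 0 \<and> (\<exists>m. n = m ^ 2) then 1 else 0)"
    by (rule fps_ext) (auto simp: phi_nth numeral_mult_nth)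
qed

lemma overpartition_gf_mod_2: obtains p where "overpartition_gf = 1 + 2 * p"
proof -
  obtain t where "phi = 1 + 2 * t" by (rule phi_mod_2)
  from arg_cong[OF this, of flip] have "flip phi = 1 + 2 * flip t" by simp
  then have "overpartition_gf * (1 + 2 * flip t) = 1" using overpartition_gf_mult_flip_phi by simp
  then have "overpartition_gf = 1 + 2 * (- overpartition_gf * flip t)" by (simp add: algebra_simps)
  then show ?thesis using that by blast
qed

text \<open>
  Odd squares are 1 modulo 4.
\<close>

lemma odd_squares_eq: obtains e where "odd_squares = fps_X * dilate (dilate e)"
proof
  have "n mod 4 = 1" if "odd n" "n = m ^ 2" for n m :: nat
  proof -
    have "odd m" using that by simp
    then obtain l where "m = 2 * l + 1" by (rule oddE)
    then have "n = 4 * (l ^ 2 + l) + 1" using that by (simp add: power2_eq_square algebra_simps)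
    then show ?thesis by simp
  qed
  then have supp: "odd_squares $ n = 0" if "n mod 4 \<noteq> 1" for n
    using that by (auto simp: odd_squares_def)
  show "odd_squares = fps_X * dilate (dilate (Abs_fps (\<lambda>n. odd_squares $ (4 * n + 1))))"
  proof (rule fps_ext)
    fix n
    show "odd_squares $ n = (fps_X * dilate (dilate (Abs_fps (\<lambda>n. odd_squares $ (4 * n + 1))))) $ n"
    proof (cases "n mod 4 = 1")
      case True
      then have n: "n = 4 * (n div 4) + 1" by presburger
      show ?thesis by (subst (1 2) n) (simp add: dilate_nth)
    next
      case False
      then have "n = 0 \<or> odd (n - 1) \<or> odd ((n - 1) div 2)" by presburger
      then show ?thesis using supp[OF False] by (auto simp: dilate_nth)
    qed
  qed
qed

text \<open>
  As \<open>1/b^4 = a^4 / b1^8\<close> and an eighth power of a series \<open>1 + 2 f\<close> is 1 modulo 8, the series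
  is \<open>(a2 + 2 c)^7 a1^2 a2 c\<close> modulo 8. In the binomial expansion the terms that do not vanish
  modulo 8 are \<open>G\<close>, which is odd, and \<open>14 a1^2 a2^7 c^2\<close>. In the latter \<open>a1^2\<close> may be replaced by 1
  because it is 1 modulo 4, which leaves \<open>14 H\<close>, and \<open>H\<close> is \<open>q^2\<close> times a series in \<open>q^4\<close>.
\<close>

lemma core_gf_nth: "8 dvd core_gf $ (4 * n)"
proof -
  obtain t where t: "phi = 1 + 2 * t" by (rule phi_mod_2)
  obtain p where p: "overpartition_gf = 1 + 2 * p" by (rule overpartition_gf_mod_2)
  obtain e where e: "odd_squares = fps_X * dilate (dilate e)" by (rule odd_squares_eq)
  define a2 a1 where "a2 = dilate (dilate phi)" and "a1 = dilate phi"
  define G where "G = a1 ^ 2 * a2 ^ 8 * odd_squares + 84 * a1 ^ 2 * a2 ^ 6 * odd_squares ^ 3"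
  define H where "H = a2 ^ 7 * odd_squares ^ 2"
  have P4: "overpartition_gf ^ 4 = phi ^ 4 * dilate overpartition_gf ^ 8"
    by (subst overpartition_gf_dilate) (simp add: power_mult_distrib flip: power_mult)
  have "8 dvd dilate overpartition_gf ^ 8 - 1"
  proof -
    have "dilate overpartition_gf = 1 + 2 * dilate p" using arg_cong[OF p, of dilate] by simp
    moreover have "(1 + 2 * x) ^ 8 - 1 = 8 * (2 * x + 14 * x ^ 2 + 56 * x ^ 3 + 140 * x ^ 4
        + 224 * x ^ 5 + 224 * x ^ 6 + 128 * x ^ 7 + 32 * x ^ 8)" for x :: "int fps"
      by algebra
    ultimately show ?thesis by (metis dvd_triv_left)
  qed
  then obtain r where r: "dilate overpartition_gf ^ 8 = 1 + 8 * r"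
    by (metis add.commute diff_add_cancel dvdE)
  have core: "core_gf = phi ^ 7 * a1 ^ 2 * a2 * odd_squares * (1 + 8 * r)"
    unfolding core_gf_def P4 r[symmetric] a1_def a2_def by (simp add: algebra_simps flip: power_add)
  have a: "phi = a2 + 2 * odd_squares" unfolding a2_def by (rule phi_split)
  have a1: "a1 ^ 2 = 1 + 4 * (dilate t + dilate t ^ 2)"
    using arg_cong[OF t, of dilate] by (simp add: a1_def power2_eq_square algebra_simps)
  have "8 dvd core_gf - G - 14 * H"
  proof -
    have "core_gf - G - 14 * H = 8 * (phi ^ 7 * a1 ^ 2 * a2 * odd_squares * r
       + 7 * (dilate t + dilate t ^ 2) * H
       + a1 ^ 2 * a2 * odd_squares * (35 * a2 ^ 4 * odd_squares ^ 3 + 70 * a2 ^ 3 * odd_squares ^ 4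
         + 84 * a2 ^ 2 * odd_squares ^ 5 + 56 * a2 * odd_squares ^ 6 + 16 * odd_squares ^ 7))"
      unfolding core G_def H_def using a a1 by algebra
    then show ?thesis by simp
  qed
  then have "8 dvd (core_gf - G - 14 * H) $ (4 * n)" by (rule numeral_dvd_nth)
  moreover have "G $ (4 * n) = 0"
  proof -
    have "flip G = - G" by (simp add: G_def a1_def a2_def flip_odd_squares)
    then have "flip G $ (4 * n) = - G $ (4 * n)" by simp
    then show ?thesis by (simp add: flip_nth)
  qed
  moreover have "H $ (4 * n) = 0"
  proof -
    have "H = fps_X ^ 2 * dilate (dilate (phi ^ 7 * e ^ 2))"
      by (simp add: H_def a2_def e power_mult_distrib)
    moreover have "odd ((4 * n - 2) div 2)" if "\<not> 4 * n < 2" using that by presburger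
    ultimately show ?thesis by (simp only: fps_X_power_mult_nth dilate_nth) auto
  qed
  ultimately show ?thesis by (simp add: numeral_mult_nth)
qed

text \<open>
  For \<open>m > 0\<close> the exponent of 2 in \<open>2 m^2\<close> is odd, so if it is at least \<open>2 t\<close>, it exceeds \<open>2 t\<close>.
\<close>

lemma four_power_dvd_double_square:
  "4 ^ t dvd 2 * m ^ 2 \<Longrightarrow> 4 ^ Suc t dvd 4 * m ^ 2" for m :: nat
proof (induction t arbitrary: m)
  case 0
  then show ?case by simp
next
  case (Suc t)
  then have "4 dvd 2 * m ^ 2" by (metis dvd_mult_left power_Suc)
  then obtain q where "2 * m ^ 2 = 4 * q" by (rule dvdE)
  then have "m ^ 2 = 2 * q" by simp
  then have "even (m ^ 2)" by simp
  then have "even m" by simp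
  then obtain l where m: "m = 2 * l" by (rule evenE)
  then have "4 ^ t dvd 2 * l ^ 2" using Suc.prems by (simp add: power_mult_distrib)
  from Suc.IH[OF this] show ?case by (simp add: m power_mult_distrib)
qed

text \<open>
  Modulo 4 the series is \<open>\<phi>(q^2)\<close>, whose coefficients vanish except at \<open>2 m^2\<close>. There the coefficient
  2 and the additional factor 2 in \<open>2 m^2\<close> make up for the missing 4.
\<close>

lemma quotient_nth:
  "4 ^ Suc t dvd int (4 ^ t * n) * (dilate phi * overpartition_gf ^ 2) $ (4 ^ t * n)"
proof -
  define N where "N = 4 ^ t * n"
  obtain p where p: "overpartition_gf = 1 + 2 * p" by (rule overpartition_gf_mod_2)
  have "dilate phi * overpartition_gf ^ 2 = dilate phi + 4 * (dilate phi * (p + p ^ 2))"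
    by (simp add: p power2_eq_square algebra_simps)
  then obtain z where z: "(dilate phi * overpartition_gf ^ 2) $ N = dilate phi $ N + 4 * z"
    by (simp add: numeral_mult_nth)
  have N: "4 ^ t dvd int N" by (simp add: N_def)
  then have "4 ^ Suc t dvd int N * (4 * z)"
    by (simp add: mult.commute mult.left_commute mult_dvd_mono)
  moreover have "4 ^ Suc t dvd int N * dilate phi $ N"
  proof (cases "N > 0 \<and> (\<exists>m. N = 2 * m ^ 2)")
    case True
    then obtain m where m: "N = 2 * m ^ 2" by auto
    have "4 ^ t dvd 2 * m ^ 2" unfolding m[symmetric] N_def by simp
    then have "4 ^ Suc t dvd 4 * m ^ 2" by (rule four_power_dvd_double_square)
    then have "int (4 ^ Suc t) dvd int (4 * m ^ 2)" by (simp only: of_nat_dvd_iff)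
    moreover have "int N * dilate phi $ N = int (4 * m ^ 2)"
      using True m by (auto simp: dilate_nth phi_nth)
    ultimately show ?thesis by simp
  next
    case False
    then have "N = 0 \<or> dilate phi $ N = 0"
      by (auto simp: dilate_nth phi_nth elim!: evenE)
    then show ?thesis by auto
  qed
  ultimately show ?thesis unfolding N_def[symmetric] z distrib_left by (rule dvd_add[rotated])
qed

theorem theorem11:
  fixes n k :: nat
  assumes "k \<in> {1, 2, 3, 4}"
  shows "[SOME_overline (2 ^ (2 * k - 1) * n) = 0] (mod (2 ^ (2 * k + 1)))"
proof -
  obtain t where k: "k = Suc t" and t: "t \<in> {0, 1, 2, 3}" using assms by auto
  define N where "N = 4 ^ t * n"
  have "2 ^ (2 * k - 1) * n = 2 * N" by (simp add: k N_def power_mult)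
  then have "SOME_overline (2 ^ (2 * k - 1) * n) = SOME_even_gf $ N"
    by (simp add: SOME_even_gf_def SOME_gf_def)
  also have "\<dots> = - 2 * (int N * (dilate phi * overpartition_gf ^ 2) $ N) + remainder_gf $ N"
    by (subst SOME_even_gf_decomp) (simp add: XD_nth numeral_mult_nth)
  finally have S: "SOME_overline (2 ^ (2 * k - 1) * n) = \<dots>" .
  have mod: "(2 :: int) ^ (2 * k + 1) = 2 * 4 ^ Suc t" by (simp add: k power_mult)
  have "2 * 4 ^ Suc t dvd remainder_gf $ N"
  proof (cases "t = 0")
    case True
    have "remainder_gf =
        8 * (dilate phi * phi ^ 2 * (dilate (dilate phi) * odd_squares) * overpartition_gf ^ 2)"
      unfolding remainder_gf_def phi_sq_diff by (simp add: ac_simps)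
    then have "8 dvd remainder_gf" by (metis dvd_triv_left)
    then have "8 dvd remainder_gf $ N" by (rule numeral_dvd_nth)
    then show ?thesis using True by simp
  next
    case False
    then obtain s where s: "t = Suc s" "s \<in> {0, 1, 2}" using t by (cases t) auto
    \<comment> \<open>for \<open>t \<ge> 1\<close> the index is even, so that only the even part of the remainder matters\<close>
    define M where "M = 2 * 4 ^ s * n"
    have "remainder_gf $ N = even_section remainder_gf $ M" by (simp add: N_def M_def s mult.assoc)
    also have "\<dots> = 64 * core_gf $ M" by (simp add: even_section_remainder_gf numeral_mult_nth)
    finally have R: "remainder_gf $ N = 64 * core_gf $ M" .
    show ?thesis
    proof (cases "s = 0")
      case True
      then show ?thesis unfolding R s by (auto intro: dvd_mult2)
    next
      case False
      then have "M = 4 * (2 * 4 ^ (s - 1) * n)" by (cases s) (simp_all add: M_def)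
      then have "8 dvd core_gf $ M" by (metis core_gf_nth)
      then have "64 * 8 dvd remainder_gf $ N" unfolding R by (rule mult_dvd_mono[OF dvd_refl])
      moreover have "(2 * 4 ^ Suc t :: int) dvd 64 * 8" using s by auto
      ultimately show ?thesis by (rule dvd_trans[rotated])
    qed
  qed
  moreover have "2 * 4 ^ Suc t dvd - 2 * (int N * (dilate phi * overpartition_gf ^ 2) $ N)"
    using mult_dvd_mono[OF dvd_refl quotient_nth[of t n], of 2] unfolding N_def[symmetric]
    by (simp only: mult_minus_left dvd_minus_iff)
  ultimately show ?thesis unfolding S cong_0_iff mod by (rule dvd_add[rotated])
qed

end
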